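(* Let $T>0$ be a real number and let $f,g:\mathbb{R}\to\mathbb{R}$ be two $C^2$-smooth functions such that $$\inf_{x\in\mathbb{R}} f(x)>\sup_{x\in\mathbb{R}} g(x).$$ Define $$\tilde f(x)=e^{-g(x)}-\frac12\left[e^{-f(x-T)}+e^{-f(x+T)}\right],\qquad x\in\mathbb{R},$$ and, for $x\in\mathbb{R}$, let $N=N(x)=\left[\frac{|x|+T}{2T}\right]$. Suppose that $$\begin{cases}\displaystyle\sum_{i=1}^{N}\tilde f'\big(x-(2i-1)T\big)\ge 0, & \forall\,x>T,\\[2mm] \displaystyle\sum_{i=1}^{N}\tilde f'\big(x+(2i-1)T\big)\le 0, & \forall\,x<-T.\end{cases}$$ Then there exists a $C^2$-smooth function $y=y(t,x)$ defined on the strip $[0,T]\times\mathbb{R}$ such that $$\begin{cases} y_{tt}-y_{xx}=y_t^2-y_x^2 & \text{on }[0,T]\times\mathbb{R},\\ y(0,x)=f(x), & x\in\mathbb{R},\\ y(T,x)=g(x), & x\in\mathbb{R}.\end{cases}$$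
   Context: $[\,\cdot\,]$ denotes the integer part of a real number, so the upper limit $N$ of the sums depends on $x$. Subscripts denote partial derivatives. *)

theory Defs
  imports "HOL-Analysis.Analysis"
begin

definition C2_real :: "(real \<Rightarrow> real) \<Rightarrow> bool" where
  "C2_real f \<longleftrightarrow>
     (\<forall>x. f differentiable at x) \<and> (\<forall>x. deriv f differentiable at x) \<and>
     continuous_on UNIV (deriv (deriv f))"

text \<open>Functions \<open>u t x\<close> on the closed strip \<open>{0..T} \<times> \<real>\<close>.  At the two boundary lines the
  derivative in \<open>t\<close> is one-sided, so none of the notions below depends on the values of \<open>u\<close>
  outside the strip (for \<open>t\<close> in \<open>{0..T}\<close> and \<open>T > 0\<close>).\<close>

definition pd_t :: "real \<Rightarrow> (real \<Rightarrow> real \<Rightarrow> real) \<Rightarrow> real \<Rightarrow> real \<Rightarrow> real" where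
  "pd_t T u t x = vector_derivative (\<lambda>s. u s x) (at t within {0..T})"

definition pd_x :: "(real \<Rightarrow> real \<Rightarrow> real) \<Rightarrow> real \<Rightarrow> real \<Rightarrow> real" where
  "pd_x u t x = deriv (\<lambda>z. u t z) x"

definition C1_strip :: "real \<Rightarrow> (real \<Rightarrow> real \<Rightarrow> real) \<Rightarrow> bool" where
  "C1_strip T u \<longleftrightarrow>
     (\<forall>t\<in>{0..T}. \<forall>x. (\<lambda>s. u s x) differentiable (at t within {0..T})) \<and>
     (\<forall>t\<in>{0..T}. \<forall>x. (\<lambda>z. u t z) differentiable (at x)) \<and>
     continuous_on ({0..T} \<times> UNIV) (\<lambda>(t, x). u t x) \<and>
     continuous_on ({0..T} \<times> UNIV) (\<lambda>(t, x). pd_t T u t x) \<and>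
     continuous_on ({0..T} \<times> UNIV) (\<lambda>(t, x). pd_x u t x)"

definition C2_strip :: "real \<Rightarrow> (real \<Rightarrow> real \<Rightarrow> real) \<Rightarrow> bool" where
  "C2_strip T u \<longleftrightarrow> C1_strip T u \<and> C1_strip T (pd_t T u) \<and> C1_strip T (pd_x u)"

definition f_tilde :: "real \<Rightarrow> (real \<Rightarrow> real) \<Rightarrow> (real \<Rightarrow> real) \<Rightarrow> real \<Rightarrow> real" where
  "f_tilde T f g x = exp (- g x) - 1/2 * (exp (- f (x - T)) + exp (- f (x + T)))"

definition N_sum :: "real \<Rightarrow> real \<Rightarrow> nat" where
  "N_sum T x = nat \<lfloor>(\<bar>x\<bar> + T) / (2 * T)\<rfloor>"

end

theory Submission
  imports Defs "HOL-Real_Asymp.Real_Asymp"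
begin

text \<open>
  With \<open>u = exp (- y)\<close> the equation becomes the wave equation, so one looks for a positive solution
  \<open>u t x = (a (x + t) + a (x - t)) / 2 + (B (x + t) - B (x - t)) / 2\<close> with \<open>a = exp (- f)\<close>.  The
  condition at \<open>t = T\<close> is \<open>B (x + T) - B (x - T) = 2 * f_tilde T f g x\<close>.  Since
  \<open>f_tilde T f g 0 > 0\<close>, one can prescribe \<open>B\<close> on \<open>[-T, T]\<close> as a nondecreasing polynomial that
  satisfies the matching conditions up to order two at the end points, and then extend it to a \<open>C\<^sup>2\<close>
  solution on the line.  Summing the differentiated difference equation, the hypotheses say exactly
  that \<open>B'\<close> at a point outside \<open>[-T, T]\<close> is at least \<open>B'\<close> at a translate inside, so \<open>B\<close> is
  nondecreasing and \<open>u > 0\<close> for \<open>t \<ge> 0\<close>.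
\<close>

subsection \<open>\<open>C\<^sup>2\<close> functions of one variable\<close>

text \<open>The derivatives are returned as equations between functions, so that regularity and the
  explicit formulas needed for matching conditions come from one argument.\<close>

lemma C2_realI:
  assumes "\<And>x. DERIV f x :> f' x" "\<And>x. DERIV f' x :> f'' x" "continuous_on UNIV f''"
  shows "C2_real f" "deriv f = f'" "deriv (deriv f) = f''"
proof -
  show 1: "deriv f = f'" using assms(1) by (auto intro!: ext DERIV_imp_deriv)
  have 2: "deriv f' = f''" using assms(2) by (auto intro!: ext DERIV_imp_deriv)
  show "deriv (deriv f) = f''" using 1 2 by simp
  show "C2_real f"
    unfolding C2_real_def 1 2 using assms
    by (auto simp: field_differentiable_def real_differentiable_def)
qed

lemma C2_realD:
  assumes "C2_real f"
  shows "DERIV f x :> deriv f x" "DERIV (deriv f) x :> deriv (deriv f) x"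
    "continuous_on UNIV (deriv (deriv f))"
  using assms unfolding C2_real_def
  by (auto simp: DERIV_deriv_iff_real_differentiable)

lemma C2_real_continuous:
  assumes "C2_real f"
  shows "continuous_on UNIV f" "continuous_on UNIV (deriv f)"
  using C2_realD[OF assms] by (blast intro: continuous_at_imp_continuous_on DERIV_isCont)+

lemma C2_real_add:
  assumes "C2_real f" "C2_real g"
  shows "C2_real (\<lambda>x. f x + g x)" "deriv (\<lambda>x. f x + g x) = (\<lambda>x. deriv f x + deriv g x)"
    "deriv (deriv (\<lambda>x. f x + g x)) = (\<lambda>x. deriv (deriv f) x + deriv (deriv g) x)"
proof -
  note D = C2_realD[OF assms(1)] C2_realD[OF assms(2)]
  have a: "\<And>x. DERIV (\<lambda>x. f x + g x) x :> deriv f x + deriv g x"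
    "\<And>x. DERIV (\<lambda>x. deriv f x + deriv g x) x :> deriv (deriv f) x + deriv (deriv g) x"
    "continuous_on UNIV (\<lambda>x. deriv (deriv f) x + deriv (deriv g) x)"
    using D by (auto intro!: derivative_intros continuous_intros)
  show "C2_real (\<lambda>x. f x + g x)" "deriv (\<lambda>x. f x + g x) = (\<lambda>x. deriv f x + deriv g x)"
    "deriv (deriv (\<lambda>x. f x + g x)) = (\<lambda>x. deriv (deriv f) x + deriv (deriv g) x)"
    by (rule C2_realI[OF a])+
qed

lemma C2_real_const: "C2_real (\<lambda>x. c)"
  by (rule C2_realI[where f' = "\<lambda>x. 0" and f'' = "\<lambda>x. 0"]) auto

lemma C2_real_cmult:
  assumes "C2_real f"
  shows "C2_real (\<lambda>x. c * f x)" "deriv (\<lambda>x. c * f x) = (\<lambda>x. c * deriv f x)"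
    "deriv (deriv (\<lambda>x. c * f x)) = (\<lambda>x. c * deriv (deriv f) x)"
proof -
  note D = C2_realD[OF assms(1)]
  have a: "\<And>x. DERIV (\<lambda>x. c * f x) x :> c * deriv f x"
    "\<And>x. DERIV (\<lambda>x. c * deriv f x) x :> c * deriv (deriv f) x"
    "continuous_on UNIV (\<lambda>x. c * deriv (deriv f) x)"
    using D by (auto intro!: DERIV_cmult continuous_intros)
  show "C2_real (\<lambda>x. c * f x)" "deriv (\<lambda>x. c * f x) = (\<lambda>x. c * deriv f x)"
    "deriv (deriv (\<lambda>x. c * f x)) = (\<lambda>x. c * deriv (deriv f) x)"
    by (rule C2_realI[OF a])+
qed

lemma C2_real_diff:
  assumes "C2_real f" "C2_real g"
  shows "C2_real (\<lambda>x. f x - g x)" "deriv (\<lambda>x. f x - g x) = (\<lambda>x. deriv f x - deriv g x)"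
    "deriv (deriv (\<lambda>x. f x - g x)) = (\<lambda>x. deriv (deriv f) x - deriv (deriv g) x)"
  using C2_real_add[OF assms(1) C2_real_cmult(1)[OF assms(2), of "-1"]]
    C2_real_cmult[OF assms(2), of "-1"] by simp_all

lemma C2_real_affine:
  assumes "C2_real f"
  shows "C2_real (\<lambda>x. f (c * x + d))" "deriv (\<lambda>x. f (c * x + d)) = (\<lambda>x. c * deriv f (c * x + d))"
    "deriv (deriv (\<lambda>x. f (c * x + d))) = (\<lambda>x. c\<^sup>2 * deriv (deriv f) (c * x + d))"
proof -
  note D = C2_realD[OF assms(1)]
  have a: "DERIV (\<lambda>x. f (c * x + d)) x :> c * deriv f (c * x + d)" for x
    by (rule DERIV_cong[OF DERIV_chain2[OF D(1)]]) (auto intro!: derivative_eq_intros)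
  have b: "DERIV (\<lambda>x. c * deriv f (c * x + d)) x :> c\<^sup>2 * deriv (deriv f) (c * x + d)" for x
    by (rule DERIV_cong[OF DERIV_cmult[OF DERIV_chain2[OF D(2)]]])
      (auto intro!: derivative_eq_intros simp: power2_eq_square)
  have c: "continuous_on UNIV (\<lambda>x. c\<^sup>2 * deriv (deriv f) (c * x + d))"
    by (intro continuous_intros continuous_on_compose2[OF D(3)]) auto
  show "C2_real (\<lambda>x. f (c * x + d))" "deriv (\<lambda>x. f (c * x + d)) = (\<lambda>x. c * deriv f (c * x + d))"
    "deriv (deriv (\<lambda>x. f (c * x + d))) = (\<lambda>x. c\<^sup>2 * deriv (deriv f) (c * x + d))"
    by (rule C2_realI[OF a b c])+
qed

lemma C2_real_shift:
  assumes "C2_real f"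
  shows "C2_real (\<lambda>x. f (x + d))" "deriv (\<lambda>x. f (x + d)) = (\<lambda>x. deriv f (x + d))"
    "deriv (deriv (\<lambda>x. f (x + d))) = (\<lambda>x. deriv (deriv f) (x + d))"
  using C2_real_affine[OF assms, of 1 d] by simp_all

lemma C2_real_shift_diff:
  assumes "C2_real f"
  shows "C2_real (\<lambda>x. f (x - d))" "deriv (\<lambda>x. f (x - d)) = (\<lambda>x. deriv f (x - d))"
    "deriv (deriv (\<lambda>x. f (x - d))) = (\<lambda>x. deriv (deriv f) (x - d))"
  using C2_real_shift[OF assms, of "- d"] by simp_all

lemma C2_real_sum:
  assumes "\<And>i. i \<in> A \<Longrightarrow> C2_real (F i)"
  shows "C2_real (\<lambda>x. \<Sum>i\<in>A. F i x)"
  using assms by (induction A rule: infinite_finite_induct) (auto intro: C2_real_const C2_real_add)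

lemma C2_real_exp_minus:
  assumes "C2_real f"
  shows "C2_real (\<lambda>x. exp (- f x))"
proof (rule C2_realI(1))
  note D = C2_realD[OF assms(1)]
  show "DERIV (\<lambda>x. exp (- f x)) x :> - deriv f x * exp (- f x)" for x
    by (auto intro!: derivative_eq_intros D)
  show "DERIV (\<lambda>x. - deriv f x * exp (- f x)) x
      :> (- deriv (deriv f) x + (deriv f x)\<^sup>2) * exp (- f x)" for x
    by (auto intro!: derivative_eq_intros D simp: algebra_simps power2_eq_square)
  show "continuous_on UNIV (\<lambda>x. (- deriv (deriv f) x + (deriv f x)\<^sup>2) * exp (- f x))"
    using C2_real_continuous[OF assms] D(3) by (intro continuous_intros)
qed

text \<open>Being twice continuously differentiable is a local property. This serves for locally
  finite sums, which agree with a finite sum only near each point.\<close>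

lemma C2_real_local:
  assumes "\<And>x. \<exists>S F. open S \<and> x \<in> S \<and> C2_real F \<and> (\<forall>z\<in>S. f z = F z)"
  shows "C2_real f"
proof -
  have "DERIV f x :> deriv f x \<and> DERIV (deriv f) x :> deriv (deriv f) x
      \<and> isCont (deriv (deriv f)) x" for x
  proof -
    obtain S F where S: "open S" "x \<in> S" and F: "C2_real F" and eq: "\<forall>z\<in>S. f z = F z"
      using assms by blast
    note D = C2_realD[OF F]
    \<comment> \<open>The derivative is identified on all of \<open>S\<close>, not only at
      \<open>x\<close>, because \<open>deriv f\<close> has to be differentiated again.\<close>
    have 1: "DERIV f z :> deriv F z" if "z \<in> S" for z
      using has_field_derivative_transform_within_open[OF D(1) S(1) that] eq by auto
    have e1: "deriv f z = deriv F z" if "z \<in> S" for z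
      using 1[OF that] by (rule DERIV_imp_deriv)
    have 2: "DERIV (deriv f) z :> deriv (deriv F) z" if "z \<in> S" for z
      using has_field_derivative_transform_within_open[OF D(2) S(1) that] e1 by auto
    have e2: "deriv (deriv f) z = deriv (deriv F) z" if "z \<in> S" for z
      using 2[OF that] by (rule DERIV_imp_deriv)
    have "continuous_on S (deriv (deriv f))"
      using continuous_on_subset[OF D(3), of S] e2 by (simp cong: continuous_on_cong)
    then have "isCont (deriv (deriv f)) x"
      using S by (simp add: continuous_on_eq_continuous_at)
    with 1 2 e1 e2 S show ?thesis by auto
  qed
  then show ?thesis
    by (intro C2_realI(1)[of f "deriv f" "deriv (deriv f)"]) (auto intro: continuous_at_imp_continuous_on)
qed

text \<open>The closures of the two pieces meet only at \<open>c\<close>, where both the values and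
  the derivatives of \<open>G\<close> and of the zero function agree.\<close>

lemma DERIV_cutoff:
  fixes G G' :: "real \<Rightarrow> real"
  assumes "\<And>x. DERIV G x :> G' x" "G c = 0" "G' c = 0"
  shows "DERIV (\<lambda>x. if c \<le> x then G x else 0) x :> (if c \<le> x then G' x else 0)"
proof -
  have U: "{c..} \<union> {..<c} = UNIV" by auto
  have "((\<lambda>x. if x \<in> {c..} then G x else 0) has_derivative
      (if x \<in> {c..} then (\<lambda>x h. G' x * h) x else (\<lambda>x h. 0) x)) (at x within {c..} \<union> {..<c})"
  proof (rule has_derivative_If_within_closures[where f' = "\<lambda>x h. G' x * h" and g' = "\<lambda>x h. 0"])
    show "(G has_derivative (\<lambda>h. G' x * h)) (at x within {c..} \<union> closure {c..} \<inter> closure {..<c})"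
      using assms(1)[of x] has_derivative_at_withinI by (auto simp: has_field_derivative_def)
  qed (use assms(2,3) in auto)
  then show ?thesis
    unfolding U by (cases "c \<le> x") (auto simp: has_field_derivative_def lambda_zero)
qed

text \<open>The cutoff rule is applied to \<open>E\<close> and then to \<open>deriv E\<close>;
  vanishing of the second derivative at \<open>c\<close> is what keeps the second derivative of the
  cutoff continuous.\<close>

lemma C2_real_cutoff:
  assumes E: "C2_real E" and z: "E c = 0" "deriv E c = 0" "deriv (deriv E) c = 0"
  shows "C2_real (\<lambda>x. if c \<le> x then E x else 0)"
proof (rule C2_realI(1))
  note D = C2_realD[OF E]
  show "DERIV (\<lambda>x. if c \<le> x then E x else 0) x :> (if c \<le> x then deriv E x else 0)" for x
    by (rule DERIV_cutoff[OF D(1) z(1,2)])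
  show "DERIV (\<lambda>x. if c \<le> x then deriv E x else 0) x
      :> (if c \<le> x then deriv (deriv E) x else 0)" for x
    by (rule DERIV_cutoff[OF D(2) z(2,3)])
  show "continuous_on UNIV (\<lambda>x. if c \<le> x then deriv (deriv E) x else 0)"
  proof -
    have "continuous_on ({c..} \<union> {..c}) (\<lambda>x. if c \<le> x then deriv (deriv E) x else 0)"
      by (intro continuous_on_cases continuous_on_subset[OF D(3)]) (auto simp: z)
    moreover have "{c..} \<union> {..c} = UNIV" by auto
    ultimately show ?thesis by simp
  qed
qed

subsection \<open>The difference equation\<close>

text \<open>The defect \<open>E\<close> of \<open>B0\<close> in the equation vanishes to order two at \<open>T\<close>, so it is the sum of \<open>C\<^sup>2\<close>
  functions supported in \<open>[T, \<infinity>)\<close> and \<open>(-\<infinity>, T]\<close>.  Their translates to the right and to the left,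
  respectively, form locally finite sums, which correct \<open>B0\<close> outside \<open>[-T, T]\<close>.\<close>

lemma C2_difference_extension:
  fixes B0 h :: "real \<Rightarrow> real"
  assumes T: "T > 0" and B0: "C2_real B0" and h: "C2_real h"
    and m0: "B0 T - B0 (- T) = h 0"
    and m1: "deriv B0 T - deriv B0 (- T) = deriv h 0"
    and m2: "deriv (deriv B0) T - deriv (deriv B0) (- T) = deriv (deriv h) 0"
  obtains B where "C2_real B" "\<And>x. B (x + T) - B (x - T) = h x"
    "\<And>x. - T < x \<Longrightarrow> x < T \<Longrightarrow> B x = B0 x"
proof -
  \<comment> \<open>The equation is centred at \<open>x - T\<close>, so the three matching
    conditions at \<open>0\<close> become vanishing conditions for \<open>E\<close> at
    \<open>T\<close>.\<close>
  define E where "E x = h (x - T) - (B0 x - B0 (x - 2 * T))" for x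
  have E: "C2_real E" unfolding E_def
    by (intro C2_real_diff C2_real_shift_diff B0 h)
  note sh = C2_real_shift_diff[OF h, of T] and sB = C2_real_shift_diff[OF B0, of "2 * T"]
  note d2 = C2_real_diff[OF B0 sB(1)]
  note dE = C2_real_diff[OF sh(1) d2(1), folded E_def]
  have "E T = 0" using m0 by (simp add: E_def)
  moreover have "deriv E T = 0" unfolding dE(2) sh(2) d2(2) sB(2) using m1 by simp
  moreover have "deriv (deriv E) T = 0" unfolding dE(3) sh(3) d2(3) sB(3) using m2 by simp
  ultimately have Ep: "C2_real (\<lambda>x. if T \<le> x then E x else 0)" by (rule C2_real_cutoff[OF E])
  define Ep where "Ep x = (if T \<le> x then E x else 0)" for x
  define Em where "Em x = E x - Ep x" for x
  have Ep2: "C2_real Ep" unfolding Ep_def by (rule Ep)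
  have Em2: "C2_real Em" unfolding Em_def by (intro C2_real_diff E Ep2)
  have Ep0: "Ep x = 0" if "x < T" for x using that by (simp add: Ep_def)
  have Em0: "Em x = 0" if "x \<ge> T" for x using that by (simp add: Em_def Ep_def)
  \<comment> \<open>Under the difference of \<open>B\<close> at \<open>x\<close> and
    \<open>x - 2 * T\<close> both series telescope, leaving \<open>Ep x + Em x = E x\<close>. The
    second series starts at the shift \<open>2 * T\<close>, since an unshifted \<open>Em\<close>
    would alter \<open>B0\<close> inside the central interval.\<close>
  define B where "B x = B0 x + (\<Sum>k. Ep (x - 2 * real k * T)) - (\<Sum>k. Em (x + 2 * real (Suc k) * T))" for x
  have Ep_far: "Ep (x - 2 * real k * T) = 0" if "x < 2 * real M * T + T" "k \<ge> M" for x k M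
  proof (rule Ep0)
    have "real M * T \<le> real k * T" using that T by simp
    then show "x - 2 * real k * T < T" using that(1) by linarith
  qed
  have Em_far: "Em (x + 2 * real (Suc k) * T) = 0" if "x > - 2 * real M * T - T" "k \<ge> M" for x k M
  proof (rule Em0)
    have "real M * T \<le> real k * T" using that T by simp
    then show "x + 2 * real (Suc k) * T \<ge> T" using that(1) by (simp add: algebra_simps)
  qed
  \<comment> \<open>Only the first \<open>M\<close> terms of each series survive on this interval;
    \<open>M = 0\<close> is the open central interval, where \<open>B\<close> is
    \<open>B0\<close>.\<close>
  have Bfin: "B x = B0 x + (\<Sum>k<M. Ep (x - 2 * real k * T)) - (\<Sum>k<M. Em (x + 2 * real (Suc k) * T))"
    if "\<bar>x\<bar> < 2 * real M * T + T" for x M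
  proof -
    have "(\<Sum>k. Ep (x - 2 * real k * T)) = (\<Sum>k<M. Ep (x - 2 * real k * T))"
      by (rule suminf_finite) (use that in \<open>auto intro!: Ep_far[of x M]\<close>)
    moreover have "(\<Sum>k. Em (x + 2 * real (Suc k) * T)) = (\<Sum>k<M. Em (x + 2 * real (Suc k) * T))"
      by (rule suminf_finite) (use that in \<open>auto intro!: Em_far[of M x] simp del: of_nat_Suc\<close>)
    ultimately show ?thesis by (simp add: B_def)
  qed
  have big: "\<exists>M. \<bar>x\<bar> < 2 * real M * T + T" for x
  proof -
    obtain M where "real M > \<bar>x\<bar> / (2 * T)" using reals_Archimedean2 by blast
    then have "\<bar>x\<bar> < 2 * real M * T" using T by (simp add: field_simps)
    then show ?thesis using T by (intro exI[of _ M]) linarith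
  qed
  show ?thesis
  proof (rule that[of B])
    show "C2_real B"
    proof (rule C2_real_local)
      fix x
      obtain M where M: "\<bar>x\<bar> < 2 * real M * T + T" using big by blast
      let ?F = "\<lambda>x. B0 x + (\<Sum>k<M. Ep (x - 2 * real k * T)) - (\<Sum>k<M. Em (x + 2 * real (Suc k) * T))"
      let ?c = "2 * real M * T + T"
      have "C2_real ?F"
        by (intro C2_real_diff C2_real_add C2_real_sum C2_real_shift[OF Em2] C2_real_shift_diff[OF Ep2] B0)
      moreover have "\<forall>z\<in>{- ?c <..< ?c}. B z = ?F z"
      proof
        fix z assume "z \<in> {- ?c <..< ?c}"
        then have "\<bar>z\<bar> < ?c" by (auto simp: abs_less_iff)
        then show "B z = ?F z" by (rule Bfin)
      qed
      moreover have "x \<in> {- ?c <..< ?c}" using M by (auto simp: abs_less_iff)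
      ultimately show "\<exists>S F. open S \<and> x \<in> S \<and> C2_real F \<and> (\<forall>z\<in>S. B z = F z)"
        by (intro exI[of _ "{- ?c <..< ?c}"] exI[of _ ?F]) (simp del: greaterThanLessThan_iff)
    qed
    show "B x = B0 x" if "- T < x" "x < T" for x
      using Bfin[of x 0] that by simp
    have step: "B x - B (x - 2 * T) = h (x - T)" for x
    proof -
      obtain M where M: "\<bar>x\<bar> < 2 * real M * T + T" using big by blast
      obtain M' where M': "\<bar>x - 2 * T\<bar> < 2 * real M' * T + T" using big by blast
      have s1: "summable (\<lambda>k. Ep (x - 2 * real k * T))"
        by (rule summable_finite[of "{..<M}"]) (use M in \<open>auto intro!: Ep_far[of x M]\<close>)
      have s2: "summable (\<lambda>k. Em (x - 2 * T + 2 * real (Suc k) * T))"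
        by (rule summable_finite[of "{..<M'}"])
          (use M' in \<open>auto intro!: Em_far[of M' "x - 2 * T"] simp del: of_nat_Suc\<close>)
      have "(\<Sum>k. Ep (x - 2 * T - 2 * real k * T)) = (\<Sum>k. Ep (x - 2 * real k * T)) - Ep x"
        using suminf_split_head[OF s1] by (simp add: algebra_simps)
      moreover have "(\<Sum>k. Em (x + 2 * real (Suc k) * T))
          = (\<Sum>k. Em (x - 2 * T + 2 * real (Suc k) * T)) - Em x"
        using suminf_split_head[OF s2] by (simp add: algebra_simps)
      ultimately have "B x - B (x - 2 * T) = B0 x - B0 (x - 2 * T) + (Ep x + Em x)"
        by (simp add: B_def)
      then show ?thesis by (simp add: Em_def E_def)
    qed
    show "B (x + T) - B (x - T) = h x" for x
      using step[of "x + T"] by simp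
  qed
qed

text \<open>The end values \<open>q, p\<close> of \<open>H'\<close> are attached to narrow bumps of width about \<open>1/n\<close> at the two
  ends, the factors being chosen so that \<open>H''(0) = 0\<close> and \<open>H''(1) = e\<close>; a multiple of
  \<open>w\<^sup>2 (1 - w)\<^sup>2\<close> then corrects the integral without changing the boundary data.\<close>

lemma unit_interval_profile:
  fixes I d e :: real
  assumes I: "I > 0"
  obtains H where "C2_real H" "H 1 - H 0 = I" "deriv H 1 - deriv H 0 = d"
    "deriv (deriv H) 1 - deriv (deriv H) 0 = e" "\<And>w. 0 \<le> w \<Longrightarrow> w \<le> 1 \<Longrightarrow> deriv H w \<ge> 0"
proof -
  \<comment> \<open>\<open>q\<close> and \<open>p\<close> are the values of \<open>H'\<close> at
    \<open>1\<close> and \<open>0\<close>: both are positive and \<open>q - p = d\<close>.\<close>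
  define q where "q = \<bar>d\<bar> + 1"
  define p where "p = q - d"
  have q: "q > 0" and p: "p \<ge> 0" by (auto simp: q_def p_def)
  \<comment> \<open>This is the integral over the unit interval of the two end bumps alone, that is,
    of \<open>H1\<close> without its \<open>m\<close> term.\<close>
  let ?J = "\<lambda>n::nat. (q + real n * q - e) / (real n + 1) - (real n * q - e) / (real n + 2)
      + p * (1 - real n / (real n + 2))"
  have "?J \<longlonglongrightarrow> 0" by real_asymp
  then have "eventually (\<lambda>n. ?J n < I) sequentially"
    using I by (rule order_tendstoD)
  moreover have "eventually (\<lambda>n::nat. real n * q \<ge> e) sequentially"
    using q by real_asymp
  ultimately have "eventually (\<lambda>n. ?J n < I \<and> real n * q \<ge> e \<and> n \<ge> 2) sequentially"
    using eventually_ge_at_top[of 2] by eventually_elim auto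
  then obtain n where n: "?J n < I" "real n * q \<ge> e" "n \<ge> 2"
    by (auto simp: eventually_sequentially)
  then obtain k where k: "n = Suc (Suc k)"
    by (metis add_2_eq_Suc le_Suc_ex)
  define J where "J = ?J n"
  \<comment> \<open>The integral of \<open>(w * (1 - w))\<^sup>2\<close> over the unit interval is
    \<open>1/30\<close>.\<close>
  define m where "m = 30 * (I - J)"
  have m: "m \<ge> 0" unfolding m_def J_def using n(1) by (intro mult_nonneg_nonneg) linarith+
  \<comment> \<open>At \<open>w = 1\<close> the second derivative of \<open>H\<close> is
    \<open>real n * q - r\<close>, which has to equal \<open>e\<close>.\<close>
  define r where "r = real n * q - e"
  define H where "H w = (q + r) * w ^ (n + 1) / (real n + 1) - r * w ^ (n + 2) / (real n + 2)
      + p * (real n * (1 - w) ^ (n + 2) / (real n + 2) - (1 - w) ^ (n + 1))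
      + m * (w ^ 3 / 3 - w ^ 4 / 2 + w ^ 5 / 5)" for w
  define H1 where "H1 w = w ^ n * (q + r * (1 - w)) + p * ((1 - w) ^ n * (1 + real n * w))
      + m * (w * (1 - w))\<^sup>2" for w
  define H2 where "H2 w = real n * w ^ (n - 1) * (q + r * (1 - w)) - r * w ^ n
      + p * (real n * (1 - w) ^ n - real n * (1 - w) ^ (n - 1) * (1 + real n * w))
      + m * (2 * (w * (1 - w)) * (1 - 2 * w))" for w
  have pow: "DERIV (\<lambda>w. w ^ Suc l / (real l + 1)) w :> w ^ l"
    "DERIV (\<lambda>w. (1 - w) ^ Suc l / (real l + 1)) w :> - ((1 - w) ^ l)" for w :: real and l
  proof -
    have "DERIV (\<lambda>w. 1 - w) w :> - 1" by (auto intro!: derivative_eq_intros)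
    from DERIV_power_Suc[OF DERIV_ident, of l w, THEN DERIV_cdivide, of "real l + 1"]
      DERIV_power_Suc[OF this, of l, THEN DERIV_cdivide, of "real l + 1"]
    show "DERIV (\<lambda>w. w ^ Suc l / (real l + 1)) w :> w ^ l"
      "DERIV (\<lambda>w. (1 - w) ^ Suc l / (real l + 1)) w :> - ((1 - w) ^ l)"
      by (simp_all add: add.commute)
  qed
  \<comment> \<open>Each power is divided by its exponent so that \<open>pow\<close> applies
    termwise. The bump at \<open>0\<close> is integrated through
    \<open>1 + n * w = (n + 1) - n * (1 - w)\<close>.\<close>
  have H_eq: "H = (\<lambda>w. (q + r) * (w ^ Suc n / (real n + 1)) - r * (w ^ Suc (n + 1) / (real (n + 1) + 1))
      + p * (real n * ((1 - w) ^ Suc (n + 1) / (real (n + 1) + 1))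
        - (real n + 1) * ((1 - w) ^ Suc n / (real n + 1)))
      + m * (w ^ Suc 2 / (real 2 + 1) - 2 * (w ^ Suc 3 / (real 3 + 1)) + w ^ Suc 4 / (real 4 + 1)))"
    by (rule ext) (simp add: H_def add.commute)
  have "DERIV H w :> (q + r) * w ^ n - r * w ^ (n + 1)
      + p * (real n * (- ((1 - w) ^ (n + 1))) - (real n + 1) * (- ((1 - w) ^ n)))
      + m * (w ^ 2 - 2 * w ^ 3 + w ^ 4)" for w
    unfolding H_eq by (intro DERIV_add DERIV_diff DERIV_cmult pow)
  moreover have "(q + r) * w ^ n - r * w ^ (n + 1)
      + p * (real n * (- ((1 - w) ^ (n + 1))) - (real n + 1) * (- ((1 - w) ^ n)))
      + m * (w ^ 2 - 2 * w ^ 3 + w ^ 4) = H1 w" for w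
    unfolding H1_def by (simp add: algebra_simps power2_eq_square eval_nat_numeral)
  ultimately have d1: "DERIV H w :> H1 w" for w by simp
  have d2: "DERIV H1 w :> H2 w" for w
    unfolding H1_def H2_def
    by (auto intro!: derivative_eq_intros simp: algebra_simps power2_eq_square)
  have c: "continuous_on UNIV H2"
    unfolding H2_def by (intro continuous_intros)
  note HH = C2_realI[OF d1 d2 c]
  show ?thesis
  proof (rule that[of H])
    show "C2_real H" by (rule HH)
    show "deriv H 1 - deriv H 0 = d"
      unfolding HH H1_def k by (simp add: p_def)
    show "deriv (deriv H) 1 - deriv (deriv H) 0 = e"
      unfolding HH(3) H2_def k by (simp add: r_def k)
    have "H 1 - H 0 = J + m / 30"
      by (simp add: H_def J_def r_def algebra_simps)
    then show "H 1 - H 0 = I" by (simp add: m_def field_simps)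
    show "deriv H w \<ge> 0" if "0 \<le> w" "w \<le> 1" for w
      unfolding HH H1_def using that q p m n(2)
      by (auto intro!: add_nonneg_nonneg mult_nonneg_nonneg simp: r_def)
  qed
qed

text \<open>An affine change of variable from the unit interval: each differentiation contributes a
  factor \<open>1 / (2 * T)\<close>, hence the rescaled data \<open>2 * T * d\<close> and
  \<open>(2 * T)\<^sup>2 * e\<close>.\<close>

lemma symmetric_interval_profile:
  fixes T I d e :: real
  assumes T: "T > 0" and I: "I > 0"
  obtains B where "C2_real B" "B T - B (- T) = I" "deriv B T - deriv B (- T) = d"
    "deriv (deriv B) T - deriv (deriv B) (- T) = e"
    "\<And>x. - T \<le> x \<Longrightarrow> x \<le> T \<Longrightarrow> deriv B x \<ge> 0"
proof -
  obtain H where H: "C2_real H" "H 1 - H 0 = I" "deriv H 1 - deriv H 0 = 2 * T * d"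
    "deriv (deriv H) 1 - deriv (deriv H) 0 = (2 * T)\<^sup>2 * e"
    "\<And>w. 0 \<le> w \<Longrightarrow> w \<le> 1 \<Longrightarrow> deriv H w \<ge> 0"
    using unit_interval_profile[OF I] by metis
  note A = C2_real_affine[OF H(1), of "1 / (2 * T)" "1 / 2"]
  have ends: "1 / (2 * T) * T + 1 / 2 = 1" "1 / (2 * T) * (- T) + 1 / 2 = 0"
    using T by (simp_all add: field_simps)
  show ?thesis
  proof (rule that[OF A(1)])
    show "H (1 / (2 * T) * T + 1 / 2) - H (1 / (2 * T) * (- T) + 1 / 2) = I"
      unfolding ends by (rule H)
    show "deriv (\<lambda>x. H (1 / (2 * T) * x + 1 / 2)) T
        - deriv (\<lambda>x. H (1 / (2 * T) * x + 1 / 2)) (- T) = d"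
      unfolding A ends right_diff_distrib[symmetric] H using T by simp
    show "deriv (deriv (\<lambda>x. H (1 / (2 * T) * x + 1 / 2))) T
        - deriv (deriv (\<lambda>x. H (1 / (2 * T) * x + 1 / 2))) (- T) = e"
      unfolding A(3) ends right_diff_distrib[symmetric] H using T by (simp add: power_divide)
    show "deriv (\<lambda>x. H (1 / (2 * T) * x + 1 / 2)) x \<ge> 0" if "- T \<le> x" "x \<le> T" for x
      unfolding A using T that
      by (intro mult_nonneg_nonneg H(5)) (auto simp: field_simps)
  qed
qed

text \<open>The sign of \<open>deriv B\<close> is arranged on the central interval by the choice of
  \<open>B0\<close>; the sum conditions carry it to the rest of the line in steps of length
  \<open>2 * T\<close>.\<close>

lemma monotone_difference_solution:
  fixes T :: real and h :: "real \<Rightarrow> real"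
  assumes T: "T > 0" and h: "C2_real h" and h0: "h 0 > 0"
    and pos: "\<And>x. x > T \<Longrightarrow> (\<Sum>i=1..N_sum T x. deriv h (x - (2 * real i - 1) * T)) \<ge> 0"
    and neg: "\<And>x. x < - T \<Longrightarrow> (\<Sum>i=1..N_sum T x. deriv h (x + (2 * real i - 1) * T)) \<le> 0"
  obtains B where "C2_real B" "\<And>x. B (x + T) - B (x - T) = h x" "mono B"
proof -
  obtain B0 where B0: "C2_real B0" "B0 T - B0 (- T) = h 0" "deriv B0 T - deriv B0 (- T) = deriv h 0"
    "deriv (deriv B0) T - deriv (deriv B0) (- T) = deriv (deriv h) 0"
    "\<And>x. - T \<le> x \<Longrightarrow> x \<le> T \<Longrightarrow> deriv B0 x \<ge> 0"
    using symmetric_interval_profile[OF T h0] by metis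
  obtain B where B: "C2_real B" "\<And>x. B (x + T) - B (x - T) = h x"
    "\<And>x. - T < x \<Longrightarrow> x < T \<Longrightarrow> B x = B0 x"
    using C2_difference_extension[OF T B0(1) h B0(2,3,4)] by metis
  let ?b = "deriv B"
  have diffeq: "?b (x + T) - ?b (x - T) = deriv h x" for x
  proof -
    note s = C2_real_shift[OF B(1), of T] and s' = C2_real_shift_diff[OF B(1), of T]
    have "(\<lambda>x. B (x + T) - B (x - T)) = h" using B(2) by auto
    then show ?thesis
      using C2_real_diff(2)[OF s(1) s'(1)] unfolding s s' by (metis (no_types))
  qed
  have "?b x \<ge> 0" if "- T < x" "x < T" for x
  proof -
    have "DERIV B x :> deriv B0 x"
      by (rule has_field_derivative_transform_within_open[OF C2_realD(1)[OF B0(1)], of "{-T<..<T}"])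
        (use that B(3) in auto)
    then show ?thesis using B0(5)[of x] that by (simp add: DERIV_imp_deriv)
  qed
  then have "{-T<..<T} \<subseteq> {x. ?b x \<ge> 0}" by auto
  \<comment> \<open>\<open>B\<close> is known to equal \<open>B0\<close> only on the open interval.
    Continuity adds the end points, which are reached by translates when
    \<open>\<bar>x\<bar> + T\<close> is a multiple of \<open>2 * T\<close>.\<close>
  moreover have "closed {x. ?b x \<ge> 0}"
    using C2_real_continuous[OF B(1)] by (intro closed_Collect_le continuous_intros)
  ultimately have "closure {-T<..<T} \<subseteq> {x. ?b x \<ge> 0}" by (rule closure_minimal)
  then have mid: "?b x \<ge> 0" if "- T \<le> x" "x \<le> T" for x
    using T that by auto
  \<comment> \<open>The odd multiples of \<open>T\<close> appear because \<open>deriv h\<close> is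
    evaluated at the midpoints of consecutive translates.\<close>
  have down: "?b x = ?b (x - 2 * real n * T) + (\<Sum>i=1..n. deriv h (x - (2 * real i - 1) * T))" for x n
  proof (induction n)
    case (Suc n)
    then show ?case using diffeq[of "x - (2 * real (Suc n) - 1) * T"]
      by (simp add: algebra_simps)
  qed simp
  have up: "?b x = ?b (x + 2 * real n * T) - (\<Sum>i=1..n. deriv h (x + (2 * real i - 1) * T))" for x n
  proof (induction n)
    case (Suc n)
    then show ?case using diffeq[of "x + (2 * real (Suc n) - 1) * T"]
      by (simp add: algebra_simps)
  qed simp
  \<comment> \<open>The integer part counts the steps of length \<open>2 * T\<close> that bring
    \<open>\<bar>x\<bar>\<close> into the central interval.\<close>
  have N: "- T \<le> \<bar>x\<bar> - 2 * real (N_sum T x) * T" "\<bar>x\<bar> - 2 * real (N_sum T x) * T \<le> T" for x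
  proof -
    let ?k = "\<lfloor>(\<bar>x\<bar> + T) / (2 * T)\<rfloor>"
    have "?k \<ge> 0" using T by simp
    then have r: "real (N_sum T x) = of_int ?k" by (simp add: N_sum_def)
    have "real (N_sum T x) \<le> (\<bar>x\<bar> + T) / (2 * T)" "(\<bar>x\<bar> + T) / (2 * T) \<le> real (N_sum T x) + 1"
      unfolding r by linarith+
    then show "- T \<le> \<bar>x\<bar> - 2 * real (N_sum T x) * T" "\<bar>x\<bar> - 2 * real (N_sum T x) * T \<le> T"
      using T by (simp_all add: field_simps)
  qed
  have nonneg: "?b x \<ge> 0" for x
  proof -
    consider "x < - T" | "- T \<le> x" "x \<le> T" | "x > T" by linarith
    then show ?thesis
    proof cases
      case 1
      with T N[of x] have "?b (x + 2 * real (N_sum T x) * T) \<ge> 0" by (intro mid) auto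
      then show ?thesis using up[of x "N_sum T x"] neg[OF 1] by linarith
    next
      case 3
      with T N[of x] have "?b (x - 2 * real (N_sum T x) * T) \<ge> 0" by (intro mid) auto
      then show ?thesis using down[of x "N_sum T x"] pos[OF 3] by linarith
    qed (rule mid)
  qed
  have "mono B"
  proof (rule monoI)
    fix x y :: real assume "x \<le> y"
    then show "B x \<le> B y"
      by (rule DERIV_nonneg_imp_nondecreasing) (use C2_realD(1)[OF B(1)] nonneg in blast)
  qed
  with B that show ?thesis by blast
qed

subsection \<open>Functions on the strip\<close>

text \<open>The explicit \<open>v\<close> need agree with \<open>u\<close> only on the strip. This
  allows iteration: \<open>pd_t T y\<close> and \<open>pd_x y\<close> are identified with formulas
  there and can then take the place of \<open>u\<close>.\<close>

lemma C1_stripI: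
  assumes T: "T > 0"
    and t: "\<And>t x. t \<in> {0..T} \<Longrightarrow> ((\<lambda>s. v s x) has_real_derivative vt t x) (at t within {0..T})"
    and x: "\<And>t x. t \<in> {0..T} \<Longrightarrow> ((\<lambda>z. v t z) has_real_derivative vx t x) (at x)"
    and c: "continuous_on ({0..T} \<times> UNIV) (\<lambda>(t, x). v t x)"
      "continuous_on ({0..T} \<times> UNIV) (\<lambda>(t, x). vt t x)"
      "continuous_on ({0..T} \<times> UNIV) (\<lambda>(t, x). vx t x)"
    and eq: "\<And>t x. t \<in> {0..T} \<Longrightarrow> u t x = v t x"
  shows "C1_strip T u" "\<And>t x. t \<in> {0..T} \<Longrightarrow> pd_t T u t x = vt t x"
    "\<And>t x. t \<in> {0..T} \<Longrightarrow> pd_x u t x = vx t x"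
proof -
  have t': "((\<lambda>s. u s x) has_real_derivative vt t x) (at t within {0..T})" if "t \<in> {0..T}" for t x
    by (rule has_field_derivative_transform_within[OF t[OF that] zero_less_one that])
      (use eq in auto)
  have x': "((\<lambda>z. u t z) has_real_derivative vx t x) (at x)" if "t \<in> {0..T}" for t x
    using x[OF that] eq[OF that] by simp
  show pt: "pd_t T u t x = vt t x" if "t \<in> {0..T}" for t x
    unfolding pd_t_def using t'[OF that, of x] T that
    by (intro vector_derivative_within_closed_interval)
      (auto simp: has_real_derivative_iff_has_vector_derivative)
  show px: "pd_x u t x = vx t x" if "t \<in> {0..T}" for t x
    unfolding pd_x_def using x'[OF that] by (rule DERIV_imp_deriv)
  have cong: "continuous_on ({0..T} \<times> UNIV) (\<lambda>(t, x). F t x)"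
    if "continuous_on ({0..T} \<times> UNIV) (\<lambda>(t, x). G t x)" "\<And>t x. t \<in> {0..T} \<Longrightarrow> F t x = G t x"
    for F G :: "real \<Rightarrow> real \<Rightarrow> real"
    using that(1) by (rule continuous_on_eq) (use that(2) in auto)
  show "C1_strip T u"
    unfolding C1_strip_def real_differentiable_def
    using t' x' cong[OF c(1) eq] cong[OF c(2) pt] cong[OF c(3) px] by blast
qed

text \<open>The argument \<open>u\<close> of the logarithm is a d'Alembert solution of the wave
  equation. For \<open>y = - ln u\<close> one has \<open>y_tt = - u_tt / u + y_t\<^sup>2\<close>,
  likewise in \<open>x\<close>, and the terms with second derivatives of \<open>u\<close> cancel in
  the difference.\<close>

lemma neg_ln_wave:
  fixes P Q :: "real \<Rightarrow> real"
  assumes T: "T > 0" and P: "C2_real P" and Q: "C2_real Q"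
    and pos: "\<And>t x. t \<in> {0..T} \<Longrightarrow> P (x + t) + Q (x - t) > 0"
  defines "y \<equiv> \<lambda>t x. - ln (P (x + t) + Q (x - t))"
  shows "C2_strip T y"
    "\<And>t x. t \<in> {0..T} \<Longrightarrow> pd_t T (pd_t T y) t x - pd_x (pd_x y) t x = (pd_t T y t x)\<^sup>2 - (pd_x y t x)\<^sup>2"
proof -
  let ?S = "{0..T} \<times> (UNIV :: real set)"
  define u where "u t x = P (x + t) + Q (x - t)" for t x
  define ux where "ux t x = deriv P (x + t) + deriv Q (x - t)" for t x
  define ut where "ut t x = deriv P (x + t) - deriv Q (x - t)" for t x
  \<comment> \<open>This one function is both second pure derivatives of \<open>u\<close>, which is
    the wave equation.\<close>
  define uxx where "uxx t x = deriv (deriv P) (x + t) + deriv (deriv Q) (x - t)" for t x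
  define uxt where "uxt t x = deriv (deriv P) (x + t) - deriv (deriv Q) (x - t)" for t x
  have u: "u t x > 0" if "t \<in> {0..T}" for t x using pos[OF that] by (simp add: u_def)
  have D: "DERIV F (x + t) :> F' \<Longrightarrow> ((\<lambda>s. F (x + s)) has_real_derivative F') (at t within {0..T})"
    "DERIV F (x - t) :> F' \<Longrightarrow> ((\<lambda>s. F (x - s)) has_real_derivative - F') (at t within {0..T})"
    "DERIV F (x + t) :> F' \<Longrightarrow> ((\<lambda>z. F (z + t)) has_real_derivative F') (at x)"
    "DERIV F (x - t) :> F' \<Longrightarrow> ((\<lambda>z. F (z - t)) has_real_derivative F') (at x)"
    for F :: "real \<Rightarrow> real" and F' t x
  proof -
    have a: "((\<lambda>s. x + s) has_real_derivative 1) (at t within {0..T})"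
      "((\<lambda>s. x - s) has_real_derivative - 1) (at t within {0..T})"
      "((\<lambda>z. z + t) has_real_derivative 1) (at x)" "((\<lambda>z. z - t) has_real_derivative 1) (at x)"
      by (auto intro!: derivative_eq_intros)
    show "DERIV F (x + t) :> F' \<Longrightarrow> ((\<lambda>s. F (x + s)) has_real_derivative F') (at t within {0..T})"
      "DERIV F (x - t) :> F' \<Longrightarrow> ((\<lambda>s. F (x - s)) has_real_derivative - F') (at t within {0..T})"
      "DERIV F (x + t) :> F' \<Longrightarrow> ((\<lambda>z. F (z + t)) has_real_derivative F') (at x)"
      "DERIV F (x - t) :> F' \<Longrightarrow> ((\<lambda>z. F (z - t)) has_real_derivative F') (at x)"
      using DERIV_chain2[OF _ a(1), of F F'] DERIV_chain2[OF _ a(2), of F F']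
        DERIV_chain2[OF _ a(3), of F F'] DERIV_chain2[OF _ a(4), of F F'] by simp_all
  qed
  note PD = C2_realD[OF P] C2_realD[OF Q]
  have du: "((\<lambda>s. u s x) has_real_derivative ut t x) (at t within {0..T})"
    "((\<lambda>z. u t z) has_real_derivative ux t x) (at x)"
    "((\<lambda>s. ut s x) has_real_derivative uxx t x) (at t within {0..T})"
    "((\<lambda>z. ut t z) has_real_derivative uxt t x) (at x)"
    "((\<lambda>s. ux s x) has_real_derivative uxt t x) (at t within {0..T})"
    "((\<lambda>z. ux t z) has_real_derivative uxx t x) (at x)" for t x
    unfolding u_def ut_def ux_def uxx_def uxt_def
    using DERIV_add[OF D(1)[OF PD(1)] D(2)[OF PD(4)]] DERIV_add[OF D(3)[OF PD(1)] D(4)[OF PD(4)]]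
      DERIV_diff[OF D(1)[OF PD(2)] D(2)[OF PD(5)]] DERIV_diff[OF D(3)[OF PD(2)] D(4)[OF PD(5)]]
      DERIV_add[OF D(1)[OF PD(2)] D(2)[OF PD(5)]] DERIV_add[OF D(3)[OF PD(2)] D(4)[OF PD(5)]]
    by simp_all
  have C: "continuous_on ?S (\<lambda>p. F (snd p + fst p))" "continuous_on ?S (\<lambda>p. F (snd p - fst p))"
    if "continuous_on UNIV F" for F :: "real \<Rightarrow> real"
    by (auto intro!: continuous_on_compose2[OF that] continuous_intros)
  note PC = C2_real_continuous[OF P] C2_real_continuous[OF Q]
  have cu: "continuous_on ?S (\<lambda>p. u (fst p) (snd p))" "continuous_on ?S (\<lambda>p. ut (fst p) (snd p))"
    "continuous_on ?S (\<lambda>p. ux (fst p) (snd p))" "continuous_on ?S (\<lambda>p. uxx (fst p) (snd p))"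
    "continuous_on ?S (\<lambda>p. uxt (fst p) (snd p))"
    unfolding u_def ut_def ux_def uxx_def uxt_def
    by (intro continuous_intros C PC PD)+
  have nz: "\<forall>p\<in>?S. u (fst p) (snd p) \<noteq> 0" "\<forall>p\<in>?S. (u (fst p) (snd p))\<^sup>2 \<noteq> 0"
    using u by (auto simp: less_imp_neq[symmetric])
  define yt where "yt t x = - ut t x / u t x" for t x
  define yx where "yx t x = - ux t x / u t x" for t x
  define ytt where "ytt t x = - uxx t x / u t x + (ut t x)\<^sup>2 / (u t x)\<^sup>2" for t x
  define yxx where "yxx t x = - uxx t x / u t x + (ux t x)\<^sup>2 / (u t x)\<^sup>2" for t x
  define yxt where "yxt t x = - uxt t x / u t x + ut t x * ux t x / (u t x)\<^sup>2" for t x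
  have y: "y t x = - ln (u t x)" for t x by (simp add: y_def u_def)
  have cy: "continuous_on ?S (\<lambda>(t, x). y t x)" "continuous_on ?S (\<lambda>(t, x). yt t x)"
    "continuous_on ?S (\<lambda>(t, x). yx t x)" "continuous_on ?S (\<lambda>(t, x). ytt t x)"
    "continuous_on ?S (\<lambda>(t, x). yxt t x)" "continuous_on ?S (\<lambda>(t, x). yxx t x)"
    unfolding y yt_def yx_def ytt_def yxx_def yxt_def split_beta
    by (intro continuous_intros cu nz)+
  have dy: "((\<lambda>s. y s x) has_real_derivative yt t x) (at t within {0..T})"
    "((\<lambda>z. y t z) has_real_derivative yx t x) (at x)"
    "((\<lambda>s. yt s x) has_real_derivative ytt t x) (at t within {0..T})"
    "((\<lambda>z. yt t z) has_real_derivative yxt t x) (at x)"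
    "((\<lambda>s. yx s x) has_real_derivative yxt t x) (at t within {0..T})"
    "((\<lambda>z. yx t z) has_real_derivative yxx t x) (at x)" if t: "t \<in> {0..T}" for t x
    unfolding y yt_def yx_def ytt_def yxx_def yxt_def
    using u[OF t, of x]
    by (auto intro!: derivative_eq_intros du simp: field_simps power2_eq_square)
  have 1: "C1_strip T y" "\<And>t x. t \<in> {0..T} \<Longrightarrow> pd_t T y t x = yt t x"
    "\<And>t x. t \<in> {0..T} \<Longrightarrow> pd_x y t x = yx t x"
    using C1_stripI[where u = y, OF T dy(1,2) cy(1,2,3)] by simp_all
  have 2: "C1_strip T (pd_t T y)" "\<And>t x. t \<in> {0..T} \<Longrightarrow> pd_t T (pd_t T y) t x = ytt t x"
    using C1_stripI[where u = "pd_t T y", OF T dy(3,4) cy(2,4,5)] 1(2) by simp_all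
  have 3: "C1_strip T (pd_x y)" "\<And>t x. t \<in> {0..T} \<Longrightarrow> pd_x (pd_x y) t x = yxx t x"
    using C1_stripI[where u = "pd_x y", OF T dy(5,6) cy(3,5,6)] 1(3) by simp_all
  show "C2_strip T y" unfolding C2_strip_def using 1(1) 2(1) 3(1) by blast
  show "pd_t T (pd_t T y) t x - pd_x (pd_x y) t x = (pd_t T y t x)\<^sup>2 - (pd_x y t x)\<^sup>2"
    if t: "t \<in> {0..T}" for t x
    unfolding 1(2)[OF t] 1(3)[OF t] 2(2)[OF t] 3(2)[OF t]
    by (simp add: ytt_def yxx_def yt_def yx_def power_divide)
qed

section \<open>Construction of the solution from the boundary data\<close>

theorem theorem7p1:
  fixes T :: real and f g :: "real \<Rightarrow> real"
  assumes "T > 0"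
    and "C2_real f" and "C2_real g"
    and "(INF x. ereal (f x)) > (SUP x. ereal (g x))"
    and "\<forall>x. x > T \<longrightarrow>
           (\<Sum>i=1..N_sum T x. deriv (f_tilde T f g) (x - (2 * real i - 1) * T)) \<ge> 0"
    and "\<forall>x. x < - T \<longrightarrow>
           (\<Sum>i=1..N_sum T x. deriv (f_tilde T f g) (x + (2 * real i - 1) * T)) \<le> 0"
  shows "\<exists>y :: real \<Rightarrow> real \<Rightarrow> real.
           C2_strip T y \<and>
           (\<forall>t\<in>{0..T}. \<forall>x.
              pd_t T (pd_t T y) t x - pd_x (pd_x y) t x
                = (pd_t T y t x)\<^sup>2 - (pd_x y t x)\<^sup>2) \<and>
           (\<forall>x. y 0 x = f x) \<and>
           (\<forall>x. y T x = g x)"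
proof -
  note T = assms(1) and f = assms(2) and g = assms(3)
  define a where "a x = exp (- f x)" for x
  define F where "F = f_tilde T f g"
  \<comment> \<open>The factor 2 cancels the one half in front of the \<open>B\<close> terms of
    d'Alembert's formula at \<open>t = T\<close>.\<close>
  define h where "h x = 2 * F x" for x
  have a: "C2_real a" unfolding a_def by (rule C2_real_exp_minus[OF f])
  have eg: "C2_real (\<lambda>x. exp (- g x))" by (rule C2_real_exp_minus[OF g])
  have F_eq: "F x = exp (- g x) - 1 / 2 * (a (x - T) + a (x + T))" for x
    by (simp add: F_def f_tilde_def a_def)
  have F: "C2_real F"
    unfolding F_eq[abs_def]
    by (intro C2_real_diff C2_real_cmult C2_real_add C2_real_shift C2_real_shift_diff a eg)
  have h: "C2_real h" and dh: "deriv h = (\<lambda>x. 2 * deriv F x)"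
    unfolding h_def using C2_real_cmult[OF F, of 2] by auto
  have gf: "g x < f z" for x z
  proof -
    have "ereal (g x) \<le> (SUP x. ereal (g x))" by (rule SUP_upper) simp
    also have "\<dots> < (INF x. ereal (f x))" using assms(4) .
    also have "\<dots> \<le> ereal (f z)" by (rule INF_lower) simp
    finally show ?thesis by simp
  qed
  \<comment> \<open>At the origin \<open>F\<close> compares \<open>exp (- g 0)\<close> with the mean
    of \<open>a (- T)\<close> and \<open>a T\<close>, both of which are smaller.\<close>
  have "a z < exp (- g 0)" for z using gf[of 0 z] by (simp add: a_def)
  from this[of "- T"] this[of T] have h0: "h 0 > 0" by (simp add: h_def F_eq)
  have "(\<Sum>i=1..N_sum T x. deriv h (x - (2 * real i - 1) * T)) \<ge> 0" if "x > T" for x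
    using assms(5) that unfolding dh sum_distrib_left[symmetric] F_def by simp
  moreover have "(\<Sum>i=1..N_sum T x. deriv h (x + (2 * real i - 1) * T)) \<le> 0" if "x < - T" for x
    using assms(6) that unfolding dh sum_distrib_left[symmetric] F_def by simp
  ultimately obtain B where B: "C2_real B" "\<And>x. B (x + T) - B (x - T) = h x" "mono B"
    using monotone_difference_solution[OF T h h0] by blast
  \<comment> \<open>\<open>P\<close> and \<open>Q\<close> are the two travelling waves with initial
    position \<open>a\<close> and initial velocity \<open>deriv B\<close>.\<close>
  define P where "P x = 1 / 2 * (a x + B x)" for x
  define Q where "Q x = 1 / 2 * (a x - B x)" for x
  have PQ: "C2_real P" "C2_real Q" unfolding P_def Q_def
    by (intro C2_real_cmult C2_real_add C2_real_diff a B)+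
  have pos: "P (x + t) + Q (x - t) > 0" if "t \<in> {0..T}" for t x
  proof -
    have "B (x - t) \<le> B (x + t)" using that by (intro monoD[OF B(3)]) auto
    moreover have "a (x + t) > 0" "a (x - t) > 0" by (auto simp: a_def)
    ultimately show ?thesis unfolding P_def Q_def by argo
  qed
  let ?y = "\<lambda>t x. - ln (P (x + t) + Q (x - t))"
  have "P (x + 0) + Q (x - 0) = exp (- f x)" for x by (simp add: P_def Q_def a_def field_simps)
  then have "?y 0 x = f x" for x by (metis ln_exp minus_minus)
  moreover have "P (x + T) + Q (x - T) = exp (- g x)" for x
    using B(2)[of x] by (simp add: P_def Q_def h_def F_eq field_simps)
  then have "?y T x = g x" for x by simp
  ultimately show ?thesis
    using neg_ln_wave[OF T PQ pos] by (intro exI[of _ ?y]) blast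
qed

end
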